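(* Let $p\ge 3$ be an integer, $q=p-1$ and $H=h^q$. Let $F_p(x,h)=\sum_{k\ge 0}R_k^{(p)}(x)\,h^{q(k+1)}$ be the distinguished reduced generating function, regarded as a formal power series in $x$ and $H$ by expanding each rational function $R_k^{(p)}$ at $x=0$. Put $\widehat X=(-1)^q x^q$ and $\widehat Y=(-1)^q q^2 H$, and for $r=1,\dots,q$ let $$\Phi_r(\widehat X,\widehat Y)=\sum_{m,n\ge0}c^{(r)}_{m,n}\widehat X^m\widehat Y^n,\qquad c^{(r)}_{m,n}=\frac{\prod_{j=0}^{q}\left(\frac{r+j}{q}\right)_{m+n}}{\prod_{j=0}^{q}\left(\frac{r+j}{q}\right)_{m}\,(2)_n\prod_{j=2}^{q+1}\left(\frac{j}{q}\right)_n}.$$ Then, as formal power series, $$F_p(x,h)=\frac{q-1}{q}\,H\sum_{r=1}^{q}(-1)^{r-1}x^r\,\Phi_r(\widehat X,\widehat Y).$$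
   Context: $(a)_n=a(a+1)\cdots(a+n-1)$, $(a)_0=1$, is the Pochhammer symbol. The rational functions $R_k^{(p)}(x)$ are defined by $$R_0^{(p)}(x)=\frac{q-1}{q}\,\frac{x}{1+x},\qquad x\frac{d^p}{dx^p}R_{k-1}^{(p)}(x)=\lambda_{p,k}R_k^{(p)}(x)\quad(k\ge1),$$ $$\lambda_{p,k}=\frac{(qk+q)(qk+1)(qk)(qk-1)\cdots(qk-q+2)}{q^2},$$ where the numerator is the factor $(qk+q)$ times the $q$ consecutive integers from $qk+1$ down to $qk-q+2$. *)

theory Defs
  imports "HOL-Complex_Analysis.Complex_Analysis"
begin

(* The product is (q k + 1)(q k) ... (q k - q + 2); subtraction is taken in complex, not in nat. *)
definition recur_const :: "nat \<Rightarrow> nat \<Rightarrow> complex" where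
  "recur_const p k =
     (let q = p - 1 in
      of_nat (q * k + q) * (\<Prod>i<q. of_nat (q * k + 1) - of_nat i) / of_nat q ^ 2)"

lemma recur_const_nonzero:
  assumes "p \<ge> 3" "k \<ge> 1"
  shows "recur_const p k \<noteq> 0"
proof -
  define q where "q = p - 1"
  have q: "q \<ge> 2" using assms by (simp add: q_def)
  have le: "q \<le> q * k" using assms(2) by simp
  have "(of_nat (q * k + 1) - of_nat i :: complex) \<noteq> 0" if "i < q" for i
  proof -
    have "q * k + 1 \<noteq> i" using that le by linarith
    then show ?thesis by (metis eq_iff_diff_eq_0 of_nat_eq_iff)
  qed
  then have "(\<Prod>i<q. of_nat (q * k + 1) - of_nat i :: complex) \<noteq> 0"
    by (simp del: of_nat_add of_nat_mult)
  moreover have "(of_nat (q * k + q) :: complex) \<noteq> 0" "(of_nat q ^ 2 :: complex) \<noteq> 0"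
    using q by (simp_all only: of_nat_eq_0_iff power_eq_0_iff) auto
  ultimately have "of_nat (q * k + q) * (\<Prod>i<q. of_nat (q * k + 1) - of_nat i) / of_nat q ^ 2 \<noteq> (0 :: complex)"
    using assms(2) by (simp del: of_nat_add of_nat_mult)
  then show ?thesis
    unfolding recur_const_def Let_def q_def .
qed

(* The rational functions R_k, as functions on the complex plane. They are regular away from
   the pole -1, where the value is irrelevant. *)
primrec R_fun :: "nat \<Rightarrow> nat \<Rightarrow> complex \<Rightarrow> complex" where
  "R_fun p 0 = (\<lambda>x. (of_nat (p - 1) - 1) / of_nat (p - 1) * (x / (1 + x)))"
| "R_fun p (Suc k) = (\<lambda>x. x * (deriv ^^ p) (R_fun p k) x / recur_const p (Suc k))"

lemma R_fun_recurrence: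
  assumes "p \<ge> 3" "k \<ge> 1"
  shows "x * (deriv ^^ p) (R_fun p (k - 1)) x = recur_const p k * R_fun p k x"
  using assms recur_const_nonzero[OF assms] by (cases k) auto

(* Series in x and H have type complex fps fps: the outer variable is H, the inner one is x. *)
abbreviation x_var :: "complex fps fps" where "x_var \<equiv> fps_const fps_X"
abbreviation H_var :: "complex fps fps" where "H_var \<equiv> fps_X"

(* F_p as a series in x and H = h^q; since h^(q(k+1)) = H^(k+1), the coefficient of H^(k+1)
   is the Taylor expansion of R_k at x = 0 and the coefficient of H^0 vanishes. *)
definition reduced_gf :: "nat \<Rightarrow> complex fps fps" where
  "reduced_gf p =
     Abs_fps (\<lambda>n. case n of 0 \<Rightarrow> 0 | Suc k \<Rightarrow> fps_expansion (R_fun p k) 0)"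

definition Phi_coeff :: "nat \<Rightarrow> nat \<Rightarrow> nat \<Rightarrow> nat \<Rightarrow> complex" where
  "Phi_coeff q r m n =
     (\<Prod>j=0..q. pochhammer (of_nat (r + j) / of_nat q) (m + n)) /
     ((\<Prod>j=0..q. pochhammer (of_nat (r + j) / of_nat q) m) * pochhammer 2 n *
      (\<Prod>j=2..q+1. pochhammer (of_nat j / of_nat q) n))"

(* Phi_r as a series in two indeterminates X (inner) and Y (outer). *)
definition Phi :: "nat \<Rightarrow> nat \<Rightarrow> complex fps fps" where
  "Phi q r = Abs_fps (\<lambda>n. Abs_fps (\<lambda>m. Phi_coeff q r m n))"

(* Simultaneous substitution X := u, Y := v in a series A(X, Y) with inner variable X and
   outer variable Y. As for fps_compose, u and v must have zero constant term. *)
definition fps_subst2 :: "complex fps fps \<Rightarrow> complex fps \<Rightarrow> complex fps fps \<Rightarrow> complex fps fps" where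
  "fps_subst2 A u v = fps_compose (Abs_fps (\<lambda>n. fps_compose (A $ n) u)) v"

definition X_hat :: "nat \<Rightarrow> complex fps" where
  "X_hat q = (-1) ^ q * fps_X ^ q"

definition Y_hat :: "nat \<Rightarrow> complex fps fps" where
  "Y_hat q = (-1) ^ q * of_nat q ^ 2 * H_var"

end

theory Submission
  imports Defs
begin

text \<open>
  Multiplying the \<open>p\<close>-th derivative by \<open>x\<close> sends \<open>x ^ (s + q)\<close> to \<open>(s)\<^sub>p x ^ s\<close>, so the Taylor
  coefficients of the \<open>R\<^sub>k\<close> satisfy a first-order recurrence in \<open>k\<close> and have a closed form as a
  quotient of Pochhammer symbols. Writing a positive exponent uniquely as \<open>s = r + q m\<close> with
  \<open>1 \<le> r \<le> q\<close> and using \<open>(a)\<^sub>m\<^sub>+\<^sub>n = (a)\<^sub>m (a + m)\<^sub>n\<close> identifies them with the coefficients of \<open>\<Phi>\<^sub>r\<close>.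
\<close>

unbundle no vec_syntax

text \<open>The Taylor coefficient at \<open>x ^ s\<close> of \<open>R_fun (Suc q) k\<close> for
  \<open>s \<ge> 1\<close>, found by iterating the recurrence in \<open>k\<close>. The sign is
  written with \<open>s + 1\<close> in place of \<open>s - 1\<close> to avoid truncated subtraction.
  For \<open>k = 0\<close> and \<open>q \<ge> 2\<close> the value at \<open>s = 0\<close> is not the
  Taylor coefficient, which is 0.\<close>

definition R_coeff :: "nat \<Rightarrow> nat \<Rightarrow> nat \<Rightarrow> complex" where
  "R_coeff q k s = (of_nat q - 1) / of_nat q * (-1) ^ (s + 1 + q * k) * of_nat q ^ (2 * k) *
     (\<Prod>j=0..q. pochhammer (of_nat (s + j) / of_nat q) k) /
     (pochhammer 2 k * (\<Prod>j=2..q+1. pochhammer (of_nat j / of_nat q) k))"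

lemma pochhammer_of_nat_div_nonzero:
  assumes "j > 0" "q > 0"
  shows "pochhammer (of_nat j / of_nat q :: 'a :: field_char_0) k \<noteq> 0"
proof
  assume "pochhammer (of_nat j / of_nat q :: 'a) k = 0"
  then obtain i where "of_nat j / of_nat q = - (of_nat i :: 'a)"
    by (auto simp: pochhammer_eq_0_iff)
  then have "of_nat j + of_nat i * of_nat q = (0 :: 'a)"
    using assms(2) by (simp add: field_simps)
  then have "of_nat (j + i * q) = (0 :: 'a)"
    by simp
  then show False
    using assms(1) by (simp only: of_nat_eq_0_iff)
qed

lemma pochhammer_2_nonzero: "pochhammer (2 :: 'a :: field_char_0) k \<noteq> 0"
  using pochhammer_of_nat_div_nonzero[of 2 1 k, where ?'a = 'a] by simp

lemma prod_pochhammer_of_nat_div_nonzero: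
  assumes "\<And>j. j \<in> A \<Longrightarrow> 0 < f j" "q > 0"
  shows "(\<Prod>j\<in>A. pochhammer (of_nat (f j) / of_nat q :: 'a :: field_char_0) k) \<noteq> 0"
proof (cases "finite A")
  case True
  then show ?thesis
    using assms by (auto simp: pochhammer_of_nat_div_nonzero)
qed simp

text \<open>Splitting off the first factor of each symbol,
  \<open>(a)\<^sub>k\<^sub>+\<^sub>1 = a (a + 1)\<^sub>k\<close>, turns \<open>s\<close> into
  \<open>s + q\<close>, since \<open>a = (s + j) / q\<close>. The factors split off are
  \<open>(s + j) / q\<close> for \<open>j = 0..q\<close>. This is the numerator half of the
  recurrence for \<open>R_coeff\<close>.\<close>

lemma prod_pochhammer_Suc_shift:
  assumes "q > 0"
  shows "of_nat q ^ (q + 1) *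
      (\<Prod>j=0..q. pochhammer (of_nat (s + j) / of_nat q :: 'a :: field_char_0) (Suc k)) =
    pochhammer (of_nat s) (q + 1) *
      (\<Prod>j=0..q. pochhammer (of_nat (s + q + j) / of_nat q) k)"
proof -
  have "pochhammer (of_nat (s + j) / of_nat q :: 'a) (Suc k) =
      (of_nat s + of_nat j) / of_nat q * pochhammer (of_nat (s + q + j) / of_nat q) k" for j
  proof -
    have "of_nat (s + j) / of_nat q + 1 = (of_nat (s + q + j) / of_nat q :: 'a)"
      using assms by (simp add: field_simps)
    then show ?thesis
      by (simp add: pochhammer_rec)
  qed
  moreover have "of_nat q ^ (q + 1) * (\<Prod>j=0..q. (of_nat s + of_nat j) / of_nat q :: 'a) =
      pochhammer (of_nat s) (q + 1)"
    using assms by (simp add: prod_dividef pochhammer_Suc_prod)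
  ultimately show ?thesis
    by (simp only: prod.distrib mult.assoc[symmetric])
qed

text \<open>The denominator half: here the last factor of each symbol is split off, and the
  resulting \<open>2 + k\<close> and \<open>j / q + k\<close> are, up to powers of \<open>q\<close>,
  exactly the factors of \<open>recur_const\<close>.\<close>

lemma prod_pochhammer_Suc_recur_const:
  assumes "q > 0"
  shows "of_nat q ^ 2 * (pochhammer 2 k * (\<Prod>j=2..q+1. pochhammer (of_nat j / of_nat q) k)) *
      recur_const (Suc q) (Suc k) =
    of_nat q ^ (q + 1) *
      (pochhammer 2 (Suc k) * (\<Prod>j=2..q+1. pochhammer (of_nat j / of_nat q :: complex) (Suc k)))"
proof -
  have "(\<Prod>i<q. of_nat (q * Suc k + 1) - of_nat i :: complex) =
      (\<Prod>j=2..q+1. of_nat j + of_nat q * of_nat k)"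
    \<comment> \<open>With \<open>j = q + 1 - i\<close> the descending factor
      \<open>q (k + 1) + 1 - i\<close> becomes \<open>j + q k\<close>.\<close>
    by (rule prod.reindex_bij_witness[of _ "\<lambda>j. q + 1 - j" "\<lambda>i. q + 1 - i"])
       (auto simp: of_nat_diff algebra_simps)
  also have "\<dots> = of_nat q ^ q * (\<Prod>j=2..q+1. of_nat j / of_nat q + of_nat k)"
  proof -
    have "of_nat j / of_nat q + of_nat k = (of_nat j + of_nat q * of_nat k) / (of_nat q :: complex)" for j
      using assms by (simp add: field_simps)
    then show ?thesis
      using assms by (simp add: prod_dividef)
  qed
  finally have P: "(\<Prod>i<q. of_nat (q * Suc k + 1) - of_nat i :: complex) = \<dots>" .
  have "recur_const (Suc q) (Suc k) * of_nat q ^ 2 =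
      of_nat (q * Suc k + q) * (\<Prod>i<q. of_nat (q * Suc k + 1) - of_nat i)"
    using assms by (simp add: recur_const_def)
  also have "of_nat (q * Suc k + q) = (of_nat q * (2 + of_nat k) :: complex)"
    by (simp add: algebra_simps)
  finally have *: "recur_const (Suc q) (Suc k) * of_nat q ^ 2 =
      of_nat q * (2 + of_nat k) * (of_nat q ^ q * (\<Prod>j=2..q+1. of_nat j / of_nat q + of_nat k))"
    by (simp only: P)
  have "of_nat q ^ 2 * (pochhammer 2 k * (\<Prod>j=2..q+1. pochhammer (of_nat j / of_nat q) k)) *
      recur_const (Suc q) (Suc k) =
    pochhammer 2 k * (\<Prod>j=2..q+1. pochhammer (of_nat j / of_nat q) k) *
      (recur_const (Suc q) (Suc k) * of_nat q ^ 2)"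
    by (simp only: mult_ac)
  then show ?thesis
    unfolding * pochhammer_Suc prod.distrib by (simp only: power_add power_one_right mult_ac)
qed

text \<open>The defining recurrence of the rational functions, read off at \<open>x ^ s\<close> with
  \<open>p = q + 1\<close>: it is the quotient of the numerator and denominator identities
  above.\<close>

lemma R_coeff_Suc:
  assumes "q > 0"
  shows "R_coeff q (Suc k) s * recur_const (Suc q) (Suc k) =
    pochhammer (of_nat s) (q + 1) * R_coeff q k (s + q)"
proof -
  define D where "D i = pochhammer 2 i * (\<Prod>j=2..q+1. pochhammer (of_nat j / of_nat q :: complex) i)" for i
  define N where "N i t = (\<Prod>j=0..q. pochhammer (of_nat (t + j) / of_nat q :: complex) i)" for i t
  \<comment> \<open>The sign exponent for \<open>(k + 1, s)\<close> equals that for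
    \<open>(k, s + q)\<close>, so \<open>c\<close> serves both sides.\<close>
  define c where "c = (of_nat q - 1) / (of_nat q :: complex) * (-1) ^ (s + 1 + q * Suc k)"
  have D0: "D i \<noteq> 0" for i
    using prod_pochhammer_of_nat_div_nonzero[of "{2..q+1}" "\<lambda>j. j" q i, where ?'a = complex] assms
    by (auto simp: D_def pochhammer_2_nonzero)
  have N: "of_nat q ^ (q + 1) * N (Suc k) s = pochhammer (of_nat s) (q + 1) * N k (s + q)"
    unfolding N_def by (rule prod_pochhammer_Suc_shift[OF assms])
  have D: "of_nat q ^ 2 * D k * recur_const (Suc q) (Suc k) = of_nat q ^ (q + 1) * D (Suc k)"
    unfolding D_def by (rule prod_pochhammer_Suc_recur_const[OF assms])
  have "R_coeff q (Suc k) s * recur_const (Suc q) (Suc k) =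
      c * of_nat q ^ (2 * k) * N (Suc k) s / D (Suc k) * (of_nat q ^ 2 * recur_const (Suc q) (Suc k))"
    by (simp add: R_coeff_def c_def N_def D_def power2_eq_square)
  also have "of_nat q ^ 2 * recur_const (Suc q) (Suc k) = of_nat q ^ (q + 1) * D (Suc k) / D k"
    using D D0[of k] by (simp add: field_simps)
  also have "c * of_nat q ^ (2 * k) * N (Suc k) s / D (Suc k) * \<dots> =
      c * of_nat q ^ (2 * k) * (of_nat q ^ (q + 1) * N (Suc k) s) / D k"
    using D0[of "Suc k"] by simp
  also have "\<dots> = pochhammer (of_nat s) (q + 1) * (c * of_nat q ^ (2 * k) * N k (s + q) / D k)"
    by (simp only: N) simp
  also have "c * of_nat q ^ (2 * k) * N k (s + q) / D k = R_coeff q k (s + q)"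
    by (simp add: R_coeff_def c_def N_def D_def algebra_simps)
  finally show ?thesis .
qed

lemma has_fps_expansion_higher_deriv:
  "f has_fps_expansion F \<Longrightarrow> (deriv ^^ n) f has_fps_expansion (fps_deriv ^^ n) F"
  by (induction n) (auto intro: has_fps_expansion_deriv)

lemma fps_higher_deriv_nth:
  "(fps_deriv ^^ n) F $ m = pochhammer (of_nat (m + 1)) n * (F :: 'a :: comm_ring_1 fps) $ (m + n)"
proof (induction n arbitrary: m)
  case (Suc n)
  have "(fps_deriv ^^ Suc n) F $ m = of_nat (m + 1) * (fps_deriv ^^ n) F $ (m + 1)"
    by simp
  also have "\<dots> = of_nat (m + 1) * (pochhammer (of_nat (m + 1) + 1) n * F $ (m + Suc n))"
    by (simp add: Suc.IH add_ac)
  finally show ?case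
    by (simp add: pochhammer_rec mult.assoc)
qed simp

text \<open>The bridge from analytic functions to formal series. Expansions depend only on the germ
  at 0 and are compatible with derivatives and products, so the recurrence for the functions becomes
  one for coefficients.\<close>

lemma R_fun_has_fps_expansion:
  assumes "q \<ge> 2"
  shows "R_fun (Suc q) k has_fps_expansion Abs_fps (\<lambda>s. if s = 0 then 0 else R_coeff q k s)"
proof (induction k)
  case 0
  let ?c = "(of_nat q - 1) / of_nat q :: complex"
  have "R_fun (Suc q) 0 has_fps_expansion fps_const ?c * (fps_X * inverse (1 + fps_X))"
    unfolding R_fun.simps diff_Suc_1 divide_inverse[of _ "1 + _"]
    by (intro fps_expansion_intros) simp
  also have "fps_const ?c * (fps_X * inverse (1 + fps_X)) =
      Abs_fps (\<lambda>s. if s = 0 then 0 else R_coeff q 0 s)"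
  proof (rule fps_ext)
    fix s
    show "(fps_const ?c * (fps_X * inverse (1 + fps_X))) $ s =
        Abs_fps (\<lambda>s. if s = 0 then 0 else R_coeff q 0 s) $ s"
      by (cases s) (simp_all add: R_coeff_def fps_inverse_fps_X_plus1[unfolded add.commute[of fps_X]])
  qed
  finally show ?case .
next
  case (Suc k)
  let ?F = "\<lambda>k. Abs_fps (\<lambda>s. if s = 0 then 0 else R_coeff q k s)"
  let ?l = "recur_const (Suc q) (Suc k)"
  have l: "?l \<noteq> 0"
    using assms by (intro recur_const_nonzero) auto
  have "R_fun (Suc q) (Suc k) has_fps_expansion
      fps_X * (fps_deriv ^^ Suc q) (?F k) * fps_const (inverse ?l)"
    unfolding R_fun.simps divide_inverse
    by (intro fps_expansion_intros has_fps_expansion_higher_deriv Suc.IH)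
  also have "fps_X * (fps_deriv ^^ Suc q) (?F k) * fps_const (inverse ?l) = ?F (Suc k)"
  proof (rule fps_ext)
    fix s
    show "(fps_X * (fps_deriv ^^ Suc q) (?F k) * fps_const (inverse ?l)) $ s = ?F (Suc k) $ s"
    proof (cases s)
      case (Suc t)
      \<comment> \<open>The factor \<open>x\<close> shifts the index, so the derivative is read at
        \<open>t = s - 1\<close>: this gives the factor \<open>(s)\<^sub>q\<^sub>+\<^sub>1\<close>
        and the old coefficient at \<open>t + q + 1 = s + q\<close>.\<close>
      then show ?thesis
        using R_coeff_Suc[of q k s] assms l
        by (simp add: fps_higher_deriv_nth divide_inverse[symmetric] nonzero_divide_eq_eq
              del: funpow.simps)
    qed simp
  qed
  finally show ?case .
qed

text \<open>The left side is the contribution of the monomial with indices \<open>m\<close>,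
  \<open>n\<close> in the \<open>r\<close>-th summand of the theorem. The symbols
  \<open>(a)\<^sub>m\<close> with \<open>a = (r + j) / q\<close> cancel, and
  \<open>a + m = (r + q m + j) / q\<close> leaves the numerator of \<open>R_coeff\<close> at
  \<open>r + q m\<close>.\<close>

lemma Phi_coeff_eq_R_coeff:
  assumes "r > 0" "q > 0"
  shows "(of_nat q - 1) / of_nat q *
      ((-1) ^ (r - 1) * (((-1) ^ q) ^ m * (((-1) ^ q * of_nat q ^ 2) ^ n * Phi_coeff q r m n))) =
    R_coeff q n (r + q * m)"
proof -
  have "pochhammer (of_nat (r + j) / of_nat q :: complex) (m + n) =
      pochhammer (of_nat (r + j) / of_nat q) m * pochhammer (of_nat (r + q * m + j) / of_nat q) n" for j
  proof -
    have "of_nat (r + j) / of_nat q + of_nat m = (of_nat (r + q * m + j) / of_nat q :: complex)"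
      using assms by (simp add: field_simps)
    then show ?thesis
      by (simp add: pochhammer_product')
  qed
  then have "Phi_coeff q r m n =
      (\<Prod>j=0..q. pochhammer (of_nat (r + q * m + j) / of_nat q) n) /
      (pochhammer 2 n * (\<Prod>j=2..q+1. pochhammer (of_nat j / of_nat q) n))"
    using prod_pochhammer_of_nat_div_nonzero[of "{0..q}" "\<lambda>j. r + j" q m, where ?'a = complex] assms
    by (simp only: Phi_coeff_def prod.distrib mult.assoc) auto
  \<comment> \<open>The two sign exponents differ by 2, because \<open>r > 0\<close> makes
    \<open>r - 1\<close> a genuine predecessor.\<close>
  then have "((-1) ^ (r - 1) * ((-1) ^ q) ^ m * ((-1) ^ q) ^ n) * of_nat q ^ (2 * n) * Phi_coeff q r m n =
      (-1) ^ (r + q * m + 1 + q * n) * of_nat q ^ (2 * n) *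
        ((\<Prod>j=0..q. pochhammer (of_nat (r + q * m + j) / of_nat q) n) /
        (pochhammer 2 n * (\<Prod>j=2..q+1. pochhammer (of_nat j / of_nat q) n)))"
    using assms by (cases r) (simp_all only: power_add power_mult diff_Suc_1, simp_all)
  then have "(-1) ^ (r - 1) * (((-1) ^ q) ^ m * (((-1) ^ q * of_nat q ^ 2) ^ n * Phi_coeff q r m n)) = \<dots>"
    by (simp only: power_mult_distrib power_mult[of _ 2 n] mult.assoc)
  then show ?thesis
    by (simp only: R_coeff_def mult.assoc times_divide_eq_left times_divide_eq_right)
qed

text \<open>The \<open>i\<close>-th power of the monomial sits in degree \<open>q i\<close>, so at
  most one \<open>i\<close> contributes to degree \<open>s\<close>.\<close>

lemma fps_compose_monom_nth:
  assumes "q > 0"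
  shows "(A oo (fps_const c * fps_X ^ q)) $ s =
    (if q dvd s then c ^ (s div q) * (A :: 'a :: comm_ring_1 fps) $ (s div q) else 0)"
proof -
  have "(A oo (fps_const c * fps_X ^ q)) $ s = (\<Sum>i=0..s. if s = q * i then c ^ i * A $ i else 0)"
    by (auto simp: fps_compose_nth power_mult_distrib power_mult[symmetric] intro!: sum.cong)
  also have "\<dots> = (\<Sum>i\<in>{i \<in> {0..s}. s = q * i}. c ^ i * A $ i)"
    by (rule sum.inter_filter[symmetric]) simp
  also have "{i \<in> {0..s}. s = q * i} = (if q dvd s then {s div q} else {})"
    using assms by auto
  finally show ?thesis
    by simp
qed

lemma fps_subst2_Phi_nth:
  assumes "q > 0"
  shows "fps_subst2 (Phi q r) (X_hat q) (Y_hat q) $ n $ s =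
    (if q dvd s
     then ((-1) ^ q) ^ (s div q) * (((-1) ^ q * of_nat q ^ 2) ^ n * Phi_coeff q r (s div q) n)
     else 0)"
proof -
  have X: "X_hat q = fps_const ((-1) ^ q) * fps_X ^ q"
    by (simp add: X_hat_def fps_const_power[symmetric] fps_const_neg[symmetric] del: fps_const_power fps_const_neg)
  \<comment> \<open>Exponent 1 and a coefficient constant in \<open>x\<close> let the same monomial
    rule handle the outer substitution.\<close>
  have Y: "Y_hat q = fps_const (fps_const ((-1) ^ q * of_nat q ^ 2)) * fps_X ^ 1"
    by (simp add: Y_hat_def fps_of_nat[symmetric] fps_const_power[symmetric] fps_const_mult[symmetric]
          fps_const_neg[symmetric] del: fps_const_power fps_const_neg fps_const_mult)
  show ?thesis
    unfolding fps_subst2_def Y fps_compose_monom_nth[OF zero_less_one]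
    unfolding X using assms
    by (simp add: fps_compose_monom_nth Phi_def fps_const_power del: fps_const_mult)
qed

theorem theorem5p1:
  fixes p q :: nat
  assumes "p \<ge> 3" and "q = p - 1"
  shows "reduced_gf p =
    fps_const (fps_const ((of_nat q - 1) / of_nat q)) * H_var *
      (\<Sum>r=1..q. (-1) ^ (r - 1) * x_var ^ r * fps_subst2 (Phi q r) (X_hat q) (Y_hat q))"
    (is "_ = fps_const (fps_const ?c) * H_var * (\<Sum>r=1..q. ?T r)")
proof (rule fps_ext, rule fps_ext)
  fix n s
  have q: "q \<ge> 2" "p = Suc q"
    using assms by auto
  \<comment> \<open>The condition \<open>r \<le> s\<close> is essential: truncated subtraction would
    otherwise make \<open>s - r = 0\<close> divisible by \<open>q\<close>.\<close>
  have T: "?T r $ k $ s = (if r \<le> s \<and> q dvd s - r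
      then (-1) ^ (r - 1) * (((-1) ^ q) ^ ((s - r) div q) *
        (((-1) ^ q * of_nat q ^ 2) ^ k * Phi_coeff q r ((s - r) div q) k)) else 0)" for r k
  proof -
    have "(-1) ^ (r - 1) * x_var ^ r = fps_const (fps_const ((-1) ^ (r - 1)) * fps_X ^ r)"
      by (simp add: fps_const_power[symmetric] fps_const_neg[symmetric] fps_const_mult[symmetric]
            del: fps_const_power fps_const_neg fps_const_mult)
    then have "?T r $ k $ s =
        (fps_const ((-1) ^ (r - 1)) * (fps_X ^ r * fps_subst2 (Phi q r) (X_hat q) (Y_hat q) $ k)) $ s"
      by (simp only: fps_mult_left_const_nth mult.assoc)
    then show ?thesis
      using q by (simp only: fps_mult_left_const_nth fps_X_power_mult_nth fps_subst2_Phi_nth) auto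
  qed
  have sum: "?c * (\<Sum>r=1..q. ?T r $ k $ s) = (if s = 0 then 0 else R_coeff q k s)" for k
  proof (cases "s = 0")
    case False
    \<comment> \<open>Dividing \<open>s - 1\<close> rather than \<open>s\<close> puts the remainder
      \<open>r\<close> in \<open>{1..q}\<close> instead of \<open>{0..<q}\<close>.\<close>
    define r m where "r = (s - 1) mod q + 1" and "m = (s - 1) div q"
    have s: "s = r + q * m" and r: "r \<in> {1..q}"
      using False q by (auto simp: r_def m_def Suc_leI)
    \<comment> \<open>A contributing \<open>r'\<close> is congruent to \<open>s\<close> modulo
      \<open>q\<close>, and \<open>{1..q}\<close> contains each residue once.\<close>
    have "?T r' $ k $ s = 0" if "r' \<in> {1..q} - {r}" for r'
    proof -
      have "\<not> (r' \<le> s \<and> q dvd s - r')"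
      proof safe
        assume "r' \<le> s" "q dvd s - r'"
        then obtain i where "s - r' = q * i"
          by (elim dvdE)
        then have "s - 1 = (r' - 1) + q * i"
          using \<open>r' \<le> s\<close> that by auto
        then have "(s - 1) mod q = (r' - 1) mod q"
          by (simp only: mod_mult_self2)
        also have "\<dots> = r' - 1"
          using that by (intro mod_less) auto
        finally have "(s - 1) mod q = r' - 1" .
        then show False
          using that by (auto simp: r_def)
      qed
      then show ?thesis
        by (simp only: T if_False)
    qed
    then have "(\<Sum>r=1..q. ?T r $ k $ s) = ?T r $ k $ s"
      using r by (intro sum.mono_neutral_right[where S = "{r}", simplified]) auto
    also have "\<dots> = (-1) ^ (r - 1) * (((-1) ^ q) ^ m * (((-1) ^ q * of_nat q ^ 2) ^ k * Phi_coeff q r m k))"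
      unfolding T using s q by simp
    finally have "(\<Sum>r=1..q. ?T r $ k $ s) = \<dots>" .
    then show ?thesis
      using Phi_coeff_eq_R_coeff[of r q m k] r q False s by simp
  next
    case True
    then have "(\<Sum>r=1..q. ?T r $ k $ s) = 0"
      unfolding T by (intro sum.neutral) auto
    with True show ?thesis
      by simp
  qed
  show "reduced_gf p $ n $ s = (fps_const (fps_const ?c) * H_var * (\<Sum>r=1..q. ?T r)) $ n $ s"
  \<comment> \<open>The factor \<open>H\<close> shifts the outer index: degree \<open>k + 1\<close>
    carries the expansion of the \<open>k\<close>-th function, and both sides vanish in degree
    0.\<close>
  proof (cases n)
    case (Suc k)
    have "reduced_gf p $ n $ s = (if s = 0 then 0 else R_coeff q k s)"
      using fps_expansion_eqI[OF R_fun_has_fps_expansion[OF q(1), of k]] Suc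
      by (simp add: reduced_gf_def q(2))
    also have "\<dots> = (fps_const (fps_const ?c) * H_var * (\<Sum>r=1..q. ?T r)) $ n $ s"
      unfolding sum[symmetric] Suc by (simp add: mult.assoc fps_sum_nth)
    finally show ?thesis .
  qed (simp add: reduced_gf_def mult.assoc)
qed

end
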